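(* Let $H$ be a commutative ring with identity, $S$ a multiplicatively closed subset of $H$, $A$ an ideal of $H$ with $A\cap S=\varnothing$, and $M$ an $H$-module. Suppose that $M$ is torsion-free and that $\bigcup_{0\neq a\in H}\mathrm{Ann}(a)\subseteq \mathrm{Ann}(M)$. Then the following statements are equivalent: (1) $A$ is an $S$-$r$-ideal of $H$. (2) $A\propto M$ is an $(S\propto 0)$-$r$-ideal of $H\propto M$. (3) $A\propto M$ is an $(S\propto M)$-$r$-ideal of $H\propto M$.
   Context: $H\propto M=\{(r,m): r\in H, m\in M\}$ is the trivial extension (idealization): addition is componentwise and $(r_1,m_1)(r_2,m_2)=(r_1r_2,r_1m_2+r_2m_1)$; its identity is $(1,0)$. For $T\subseteq H$ and $N\subseteq M$, $T\propto N=\{(t,n): t\in T,n\in N\}$, and $S\propto 0=S\propto\{0\}$. For an element $w$ of a ring $R$, $\mathrm{Ann}(w)=\{y\in R: yw=0\}$; $\mathrm{Ann}(M)=\{r\in H: rM=0\}$. $M$ is torsion-free if $rm=0$ with $r\in H$ satisfying $\mathrm{Ann}(r)=0$ and $m\in M$ implies $m=0$. A multiplicatively closed subset of a ring is a subset containing $1$ and closed under products. An ideal $A$ of a ring $R$ is an $S$-$r$-ideal if $A\cap S=\varnothing$ and there exists $s\in S$ such that for all $w,z\in R$, if $wz\in A$ and $\mathrm{Ann}(w)=0$, then $sz\in A$. *)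

theory Defs
  imports "HOL-Algebra.Algebra"
begin

definition trivial_extension ::
    "('a, 'c) ring_scheme \<Rightarrow> ('a, 'b, 'd) module_scheme \<Rightarrow> ('a \<times> 'b) ring"  (infixl \<open>\<propto>\<close> 75)
  where "H \<propto> M =
    \<lparr> carrier = carrier H \<times> carrier M,
      monoid.mult = (\<lambda>(r\<^sub>1, m\<^sub>1) (r\<^sub>2, m\<^sub>2).
        (r\<^sub>1 \<otimes>\<^bsub>H\<^esub> r\<^sub>2, (r\<^sub>1 \<odot>\<^bsub>M\<^esub> m\<^sub>2) \<oplus>\<^bsub>M\<^esub> (r\<^sub>2 \<odot>\<^bsub>M\<^esub> m\<^sub>1))),
      one = (\<one>\<^bsub>H\<^esub>, \<zero>\<^bsub>M\<^esub>),
      ring.zero = (\<zero>\<^bsub>H\<^esub>, \<zero>\<^bsub>M\<^esub>),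
      ring.add = (\<lambda>(r\<^sub>1, m\<^sub>1) (r\<^sub>2, m\<^sub>2). (r\<^sub>1 \<oplus>\<^bsub>H\<^esub> r\<^sub>2, m\<^sub>1 \<oplus>\<^bsub>M\<^esub> m\<^sub>2)) \<rparr>"

definition Ann :: "('a, 'c) ring_scheme \<Rightarrow> 'a \<Rightarrow> 'a set"
  where "Ann R w = {y \<in> carrier R. y \<otimes>\<^bsub>R\<^esub> w = \<zero>\<^bsub>R\<^esub>}"

definition module_Ann :: "('a, 'c) ring_scheme \<Rightarrow> ('a, 'b, 'd) module_scheme \<Rightarrow> 'a set"
  where "module_Ann R M = {r \<in> carrier R. \<forall>m \<in> carrier M. r \<odot>\<^bsub>M\<^esub> m = \<zero>\<^bsub>M\<^esub>}"

definition torsion_free :: "('a, 'c) ring_scheme \<Rightarrow> ('a, 'b, 'd) module_scheme \<Rightarrow> bool"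
  where "torsion_free R M \<longleftrightarrow>
    (\<forall>r \<in> carrier R. \<forall>m \<in> carrier M.
       Ann R r = {\<zero>\<^bsub>R\<^esub>} \<longrightarrow> r \<odot>\<^bsub>M\<^esub> m = \<zero>\<^bsub>M\<^esub> \<longrightarrow> m = \<zero>\<^bsub>M\<^esub>)"

text \<open>
  Here \<open>S\<close> is meant to be a multiplicatively closed subset of \<open>R\<close>, i.e. \<open>submonoid S R\<close>.
  The element \<open>s\<close> is chosen once, uniformly in \<open>w\<close> and \<open>z\<close>.
\<close>

definition S_r_ideal :: "('a, 'c) ring_scheme \<Rightarrow> 'a set \<Rightarrow> 'a set \<Rightarrow> bool"
  where "S_r_ideal R S A \<longleftrightarrow>
    ideal A R \<and> A \<inter> S = {} \<and>
    (\<exists>s \<in> S. \<forall>w \<in> carrier R. \<forall>z \<in> carrier R.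
       w \<otimes>\<^bsub>R\<^esub> z \<in> A \<longrightarrow> Ann R w = {\<zero>\<^bsub>R\<^esub>} \<longrightarrow> s \<otimes>\<^bsub>R\<^esub> z \<in> A)"

lemma trivial_extension_simps [simp]:
  "carrier (H \<propto> M) = carrier H \<times> carrier M"
  "(r\<^sub>1, m\<^sub>1) \<otimes>\<^bsub>H \<propto> M\<^esub> (r\<^sub>2, m\<^sub>2) =
     (r\<^sub>1 \<otimes>\<^bsub>H\<^esub> r\<^sub>2, (r\<^sub>1 \<odot>\<^bsub>M\<^esub> m\<^sub>2) \<oplus>\<^bsub>M\<^esub> (r\<^sub>2 \<odot>\<^bsub>M\<^esub> m\<^sub>1))"
  "\<one>\<^bsub>H \<propto> M\<^esub> = (\<one>\<^bsub>H\<^esub>, \<zero>\<^bsub>M\<^esub>)"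
  "\<zero>\<^bsub>H \<propto> M\<^esub> = (\<zero>\<^bsub>H\<^esub>, \<zero>\<^bsub>M\<^esub>)"
  "(r\<^sub>1, m\<^sub>1) \<oplus>\<^bsub>H \<propto> M\<^esub> (r\<^sub>2, m\<^sub>2) = (r\<^sub>1 \<oplus>\<^bsub>H\<^esub> r\<^sub>2, m\<^sub>1 \<oplus>\<^bsub>M\<^esub> m\<^sub>2)"
  by (simp_all add: trivial_extension_def)

lemma cring_trivial_extension:
  assumes "module H M"
  shows "cring (H \<propto> M)"
proof -
  interpret module H M by fact
  show ?thesis
  proof (rule cringI)
    show "abelian_group (H \<propto> M)"
    proof (rule abelian_groupI)
      fix x assume "x \<in> carrier (H \<propto> M)"
      then show "\<exists>y \<in> carrier (H \<propto> M). y \<oplus>\<^bsub>H \<propto> M\<^esub> x = \<zero>\<^bsub>H \<propto> M\<^esub>"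
        by (intro bexI[of _ "(\<ominus>\<^bsub>H\<^esub> fst x, \<ominus>\<^bsub>M\<^esub> snd x)"])
          (auto simp: R.l_neg M.l_neg)
    qed (auto simp: R.a_ac M.a_ac)
    show "comm_monoid (H \<propto> M)"
      by (rule comm_monoidI)
        (auto simp: R.m_ac M.a_ac smult_r_distr smult_assoc1[symmetric])
    show "(x \<oplus>\<^bsub>H \<propto> M\<^esub> y) \<otimes>\<^bsub>H \<propto> M\<^esub> z = x \<otimes>\<^bsub>H \<propto> M\<^esub> z \<oplus>\<^bsub>H \<propto> M\<^esub> y \<otimes>\<^bsub>H \<propto> M\<^esub> z"
      if "x \<in> carrier (H \<propto> M)" "y \<in> carrier (H \<propto> M)" "z \<in> carrier (H \<propto> M)" for x y z
      using that by (auto simp: R.l_distr M.a_ac smult_l_distr smult_r_distr)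
  qed
qed

lemma submonoid_trivial_extension:
  assumes "module H M" "submonoid S H"
  shows "submonoid (S \<times> {\<zero>\<^bsub>M\<^esub>}) (H \<propto> M)" "submonoid (S \<times> carrier M) (H \<propto> M)"
proof -
  interpret module H M by fact
  interpret S: submonoid S H by fact
  show "submonoid (S \<times> {\<zero>\<^bsub>M\<^esub>}) (H \<propto> M)" "submonoid (S \<times> carrier M) (H \<propto> M)"
    by (unfold_locales; force simp: smult_r_null)+
qed

end

theory Submission
  imports Defs
begin

text \<open>
  An element \<open>(r, m)\<close> of \<open>H \<propto> M\<close> has zero annihilator exactly when its first component \<open>r\<close> has
  zero annihilator in \<open>H\<close>. Torsion-freeness of \<open>M\<close> lifts regularity from \<open>H\<close> to \<open>H \<propto> M\<close>; the
  hypothesis that zero divisors of \<open>H\<close> kill \<open>M\<close> brings it back (\<open>Ann_trivial_extension_eq_zero_iff\<close>).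

  Membership of a product in \<open>A \<propto> M\<close> also depends on first components alone. Every part of
  the definition of an \<open>S\<close>-\<open>r\<close>-ideal, applied to \<open>A \<propto> M\<close>, is therefore the same condition on
  \<open>A\<close>, read through the projection \<open>H \<propto> M \<rightarrow> H\<close>. So only the projection of the multiplicative set
  matters (\<open>S_r_ideal_trivial_extension_iff\<close>), and both \<open>S \<propto> 0\<close> and \<open>S \<propto> M\<close> project onto \<open>S\<close>.
\<close>

lemma Ann_eq_zero_iff:
  assumes "cring R" "w \<in> carrier R"
  shows "Ann R w = {\<zero>\<^bsub>R\<^esub>} \<longleftrightarrow> (\<forall>y \<in> carrier R. y \<otimes>\<^bsub>R\<^esub> w = \<zero>\<^bsub>R\<^esub> \<longrightarrow> y = \<zero>\<^bsub>R\<^esub>)"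
proof -
  interpret cring R by fact
  show ?thesis using assms(2) by (auto simp: Ann_def)
qed

text \<open>
  If \<open>(r, m)\<close> is regular and \<open>r \<noteq> \<zero>\<close>, then any \<open>y\<close> with \<open>y r = \<zero>\<close> kills \<open>M\<close>, so \<open>(y, \<zero>)\<close> kills
  \<open>(r, m)\<close> and \<open>y\<close> vanishes. The elements \<open>(\<zero>, m)\<close> escape this argument, but they are nilpotent
  and hence regular only over the zero ring. Conversely, if \<open>r\<close> is regular and \<open>(y, n) (r, m) = \<zero>\<close>,
  then \<open>y = \<zero>\<close>, which leaves \<open>r n = \<zero>\<close> for torsion-freeness.
\<close>

lemma Ann_trivial_extension_eq_zero_iff:
  assumes "module H M" and tf: "torsion_free H M"
    and zd: "(\<Union>a \<in> carrier H - {\<zero>\<^bsub>H\<^esub>}. Ann H a) \<subseteq> module_Ann H M"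
    and r: "r \<in> carrier H" and m: "m \<in> carrier M"
  shows "Ann (H \<propto> M) (r, m) = {\<zero>\<^bsub>H \<propto> M\<^esub>} \<longleftrightarrow> Ann H r = {\<zero>\<^bsub>H\<^esub>}"
proof -
  interpret module H M by fact
  interpret E: cring "H \<propto> M" by (rule cring_trivial_extension) fact
  have rm: "(r, m) \<in> carrier (H \<propto> M)" using r m by simp
  note regE = Ann_eq_zero_iff[OF E.is_cring rm]
  note regH = Ann_eq_zero_iff[OF R.is_cring r]
  show ?thesis
  proof
    assume reg: "Ann H r = {\<zero>\<^bsub>H\<^esub>}"
    show "Ann (H \<propto> M) (r, m) = {\<zero>\<^bsub>H \<propto> M\<^esub>}"
      unfolding regE
    proof (intro ballI impI)
      fix x assume "x \<in> carrier (H \<propto> M)" and "x \<otimes>\<^bsub>H \<propto> M\<^esub> (r, m) = \<zero>\<^bsub>H \<propto> M\<^esub>"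
      then obtain y n where x: "x = (y, n)" and y: "y \<in> carrier H" and n: "n \<in> carrier M"
        and yr: "y \<otimes>\<^bsub>H\<^esub> r = \<zero>\<^bsub>H\<^esub>"
        and ymrn: "y \<odot>\<^bsub>M\<^esub> m \<oplus>\<^bsub>M\<^esub> r \<odot>\<^bsub>M\<^esub> n = \<zero>\<^bsub>M\<^esub>"
        by auto
      have y0: "y = \<zero>\<^bsub>H\<^esub>" using reg yr y regH by blast
      with ymrn have "r \<odot>\<^bsub>M\<^esub> n = \<zero>\<^bsub>M\<^esub>" using r m n by (simp add: smult_l_null)
      with tf reg r n have "n = \<zero>\<^bsub>M\<^esub>" unfolding torsion_free_def by blast
      with x y0 show "x = \<zero>\<^bsub>H \<propto> M\<^esub>" by simp
    qed
  next
    assume "Ann (H \<propto> M) (r, m) = {\<zero>\<^bsub>H \<propto> M\<^esub>}"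
    then have kill: "(y, n) = \<zero>\<^bsub>H \<propto> M\<^esub>"
      if "y \<in> carrier H" "n \<in> carrier M" "(y, n) \<otimes>\<^bsub>H \<propto> M\<^esub> (r, m) = \<zero>\<^bsub>H \<propto> M\<^esub>" for y n
      using that regE by auto
    show "Ann H r = {\<zero>\<^bsub>H\<^esub>}"
      unfolding regH
    proof (intro ballI impI)
      fix y assume y: "y \<in> carrier H" and yr: "y \<otimes>\<^bsub>H\<^esub> r = \<zero>\<^bsub>H\<^esub>"
      show "y = \<zero>\<^bsub>H\<^esub>"
      proof (cases "r = \<zero>\<^bsub>H\<^esub>")
        case True
        \<comment> \<open>Since \<open>(\<zero>, m)\<close> squares to zero, regularity forces \<open>m = \<zero>\<close>, and then \<open>(y, \<zero>)\<close> kills \<open>(r, m)\<close>.\<close>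
        have "m = \<zero>\<^bsub>M\<^esub>" using kill[of "\<zero>\<^bsub>H\<^esub>" m] True m by (simp add: smult_l_null)
        then show ?thesis using kill[of y "\<zero>\<^bsub>M\<^esub>"] True y by (simp add: smult_r_null)
      next
        case False
        \<comment> \<open>Now \<open>y\<close> annihilates a nonzero element of \<open>H\<close>, so it kills \<open>M\<close>.\<close>
        then have "y \<in> module_Ann H M" using zd r y yr unfolding Ann_def by blast
        then have "y \<odot>\<^bsub>M\<^esub> m = \<zero>\<^bsub>M\<^esub>" using m by (simp add: module_Ann_def)
        then show ?thesis using kill[of y "\<zero>\<^bsub>M\<^esub>"] yr y r by (simp add: smult_r_null)
      qed
    qed
  qed
qed

lemma ideal_trivial_extension:
  assumes "module H M" "ideal A H"
  shows "ideal (A \<times> carrier M) (H \<propto> M)"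
proof -
  interpret module H M by fact
  interpret A: ideal A H by fact
  interpret E: cring "H \<propto> M" by (rule cring_trivial_extension) fact
  show ?thesis
  proof (rule idealI)
    show "ring (H \<propto> M)" by (rule E.ring_axioms)
    show "subgroup (A \<times> carrier M) (add_monoid (H \<propto> M))"
    proof (rule group.subgroupI)
      show "group (add_monoid (H \<propto> M))" by (rule E.a_group)
      show "A \<times> carrier M \<subseteq> carrier (add_monoid (H \<propto> M))"
        using A.a_subset by (simp add: Sigma_mono)
      show "A \<times> carrier M \<noteq> {}" using A.zero_closed M.zero_closed by blast
    next
      fix x assume "x \<in> A \<times> carrier M"
      then obtain a m where am: "x = (a, m)" "a \<in> A" "m \<in> carrier M" by auto
      have "(\<ominus>\<^bsub>H\<^esub> a, \<ominus>\<^bsub>M\<^esub> m) \<oplus>\<^bsub>H \<propto> M\<^esub> x = \<zero>\<^bsub>H \<propto> M\<^esub>"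
        using am by (simp add: R.l_neg M.l_neg)
      then have "\<ominus>\<^bsub>H \<propto> M\<^esub> x = (\<ominus>\<^bsub>H\<^esub> a, \<ominus>\<^bsub>M\<^esub> m)"
        using am by (intro E.minus_equality) simp_all
      then have "\<ominus>\<^bsub>H \<propto> M\<^esub> x \<in> A \<times> carrier M" using am by simp
      then show "inv\<^bsub>add_monoid (H \<propto> M)\<^esub> x \<in> A \<times> carrier M" by (simp only: a_inv_def)
    next
      fix x y assume "x \<in> A \<times> carrier M" "y \<in> A \<times> carrier M"
      then show "x \<otimes>\<^bsub>add_monoid (H \<propto> M)\<^esub> y \<in> A \<times> carrier M" by (elim SigmaE) simp
    qed
  qed (auto simp: A.I_l_closed A.I_r_closed)
qed

text \<open>
  The three equivalent conditions differ only in their multiplicative set, so they are all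
  instances of a single comparison along the projection.
\<close>

lemma S_r_ideal_trivial_extension_iff:
  assumes "module H M" "torsion_free H M"
    and "(\<Union>a \<in> carrier H - {\<zero>\<^bsub>H\<^esub>}. Ann H a) \<subseteq> module_Ann H M"
    and "ideal A H"
    and T: "T \<subseteq> carrier (H \<propto> M)"
  shows "S_r_ideal (H \<propto> M) T (A \<times> carrier M) \<longleftrightarrow> S_r_ideal H (fst ` T) A"
proof -
  interpret module H M by fact
  note reg = Ann_trivial_extension_eq_zero_iff[OF assms(1-3)]
  have "t \<in> A \<times> carrier M \<longleftrightarrow> fst t \<in> A" if "t \<in> T" for t
    using subsetD[OF T that] by (simp add: mem_Times_iff)
  then have disj: "(A \<times> carrier M) \<inter> T = {} \<longleftrightarrow> A \<inter> fst ` T = {}"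
    by blast
  have mult_mem: "(a, m) \<otimes>\<^bsub>H \<propto> M\<^esub> (b, n) \<in> A \<times> carrier M \<longleftrightarrow> a \<otimes>\<^bsub>H\<^esub> b \<in> A"
    if "a \<in> carrier H" "b \<in> carrier H" "m \<in> carrier M" "n \<in> carrier M" for a b m n
    using that by simp
  have witness: "(\<forall>w \<in> carrier (H \<propto> M). \<forall>z \<in> carrier (H \<propto> M).
        w \<otimes>\<^bsub>H \<propto> M\<^esub> z \<in> A \<times> carrier M \<longrightarrow> Ann (H \<propto> M) w = {\<zero>\<^bsub>H \<propto> M\<^esub>} \<longrightarrow>
        t \<otimes>\<^bsub>H \<propto> M\<^esub> z \<in> A \<times> carrier M) \<longleftrightarrow>
      (\<forall>w \<in> carrier H. \<forall>z \<in> carrier H.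
        w \<otimes>\<^bsub>H\<^esub> z \<in> A \<longrightarrow> Ann H w = {\<zero>\<^bsub>H\<^esub>} \<longrightarrow> fst t \<otimes>\<^bsub>H\<^esub> z \<in> A)"
    if "t \<in> T" for t
  proof -
    obtain s k where t: "t = (s, k)" and sk: "s \<in> carrier H" "k \<in> carrier M"
      using subsetD[OF T \<open>t \<in> T\<close>] by auto
    have split: "(\<forall>x \<in> carrier (H \<propto> M). P x) \<longleftrightarrow> (\<forall>a \<in> carrier H. \<forall>m \<in> carrier M. P (a, m))"
      for P by auto
    have nonempty: "\<exists>m. m \<in> carrier M" using M.zero_closed by blast
    have "(\<forall>a \<in> carrier H. \<forall>m \<in> carrier M. \<forall>b \<in> carrier H. \<forall>n \<in> carrier M.
        (a, m) \<otimes>\<^bsub>H \<propto> M\<^esub> (b, n) \<in> A \<times> carrier M \<longrightarrow>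
        Ann (H \<propto> M) (a, m) = {\<zero>\<^bsub>H \<propto> M\<^esub>} \<longrightarrow>
        (s, k) \<otimes>\<^bsub>H \<propto> M\<^esub> (b, n) \<in> A \<times> carrier M) \<longleftrightarrow>
      (\<forall>a \<in> carrier H. \<forall>m \<in> carrier M. \<forall>b \<in> carrier H. \<forall>n \<in> carrier M.
        a \<otimes>\<^bsub>H\<^esub> b \<in> A \<longrightarrow> Ann H a = {\<zero>\<^bsub>H\<^esub>} \<longrightarrow> s \<otimes>\<^bsub>H\<^esub> b \<in> A)"
      by (intro ball_cong refl) (simp only: mult_mem reg sk)
    with nonempty show ?thesis
      unfolding split t by (simp del: trivial_extension_simps)
  qed
  show ?thesis
    using ideal_trivial_extension[OF assms(1,4)] assms(4)
    by (simp add: S_r_ideal_def disj witness cong: bex_cong del: trivial_extension_simps)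
qed

theorem proposition3p2:
  fixes H :: "('a, 'c) ring_scheme" and M :: "('a, 'b, 'd) module_scheme"
    and S A :: "'a set"
  assumes "cring H"
    and "submonoid S H"
    and "ideal A H"
    and "A \<inter> S = {}"
    and "module H M"
    and "torsion_free H M"
    and "(\<Union>a \<in> carrier H - {\<zero>\<^bsub>H\<^esub>}. Ann H a) \<subseteq> module_Ann H M"
  shows "(S_r_ideal H S A
            \<longleftrightarrow> S_r_ideal (H \<propto> M) (S \<times> {\<zero>\<^bsub>M\<^esub>}) (A \<times> carrier M))
       \<and> (S_r_ideal (H \<propto> M) (S \<times> {\<zero>\<^bsub>M\<^esub>}) (A \<times> carrier M)
            \<longleftrightarrow> S_r_ideal (H \<propto> M) (S \<times> carrier M) (A \<times> carrier M))"
proof -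
  interpret module H M by fact
  interpret S: submonoid S H by fact
  note proj = S_r_ideal_trivial_extension_iff[OF assms(5,6,7,3)]
  have "S_r_ideal (H \<propto> M) (S \<times> {\<zero>\<^bsub>M\<^esub>}) (A \<times> carrier M) \<longleftrightarrow> S_r_ideal H S A"
    using proj[of "S \<times> {\<zero>\<^bsub>M\<^esub>}"] S.subset by (simp add: subset_iff)
  moreover have "S_r_ideal (H \<propto> M) (S \<times> carrier M) (A \<times> carrier M) \<longleftrightarrow> S_r_ideal H S A"
  proof -
    have "carrier M \<noteq> {}" using M.zero_closed by blast
    then show ?thesis using proj[of "S \<times> carrier M"] S.subset by (simp add: subset_iff)
  qed
  ultimately show ?thesis by blast
qed

end
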